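(* Let $0<\gamma<1$ and $0\le p\le1$, and let $F$ be a fixed graph on $[k]$ which is hereditary induced-forcing for $p$. Then every sequence $(G_n)$ of graphs with $|G_n|\to\infty$ for which there is a sequence $\varepsilon_n\to0$ such that for every $n$ and every $U\subseteq V(G_n)$ with $|U|=\lfloor\gamma|G_n|\rfloor$, $$\bigl|N^*(F,G_n;U)-\beta_F(p)|U|^k\bigr|\le\varepsilon_n|G_n|^k,$$ is $[p,\bar p]$-quasi-random.
   Context: Graphs are finite and simple. For a graph $F$ on $[k]$, a graph $G$ and $U\subseteq V(G)$, $N^*(F,G;U)$ is the number of injective maps $\varphi:V(F)\to U$ such that for all $i\ne j$, $ij\in E(F)$ iff $\varphi(i)\varphi(j)\in E(G)$. $N(H,G)$ is the number of injective homomorphisms $V(H)\to V(G)$. A sequence $(G_n)$ with $|G_n|\to\infty$ is $q$-quasi-random if $N(H,G_n)=(q^{e(H)}+o(1))|G_n|^{|H|}$ for every graph $H$. Let $\beta_F(q)=q^{e(F)}(1-q)^{\binom k2-e(F)}$. If $F$ is neither empty nor complete, with $p_F=e(F)/\binom k2$, for $q\ne p_F$ the conjugate $\bar q$ is the unique other number in $[0,1]$ with $\beta_F(\bar q)=\beta_F(q)$; $\bar q=q$ if $q=p_F$ or $F$ is empty or complete. $(G_n)$ is $[p,\bar p]$-quasi-random if $\mathbb N$ splits into $I_1,I_2$ with $(G_n)_{n\in I_1}$ $p$-quasi-random (if infinite) and $(G_n)_{n\in I_2}$ $\bar p$-quasi-random (if infinite). $F$ is hereditary induced-forcing for $p$ if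 every sequence $(G_n)$ with $|G_n|\to\infty$ satisfying $N^*(F,G_n;U)=\beta_F(p)|U|^k+o(|G_n|^k)$ uniformly over all subsets $U\subseteq V(G_n)$ is $[p,\bar p]$-quasi-random. *)

theory Defs
  imports
    "HOL-Analysis.Analysis"
    "HOL-Library.FuncSet"
    "HOL-Library.Ramsey"
    "HOL-Library.Landau_Symbols"
begin

datatype 'a ugraph = UGraph (verts: "'a set") (edges: "'a set set")

definition simple_graph :: "'a ugraph \<Rightarrow> bool" where
  "simple_graph G \<longleftrightarrow> finite (verts G) \<and> edges G \<subseteq> nsets (verts G) 2"

abbreviation gorder :: "'a ugraph \<Rightarrow> nat" where
  "gorder G \<equiv> card (verts G)"

abbreviation gsize :: "'a ugraph \<Rightarrow> nat" where
  "gsize G \<equiv> card (edges G)"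

text \<open>
  Maps defined on the vertex set are represented by extensional functions, so that each map
  is counted once.
\<close>

definition num_injhom :: "'b ugraph \<Rightarrow> 'a ugraph \<Rightarrow> nat" where
  "num_injhom H G =
     card {\<phi> \<in> verts H \<rightarrow>\<^sub>E verts G.
             inj_on \<phi> (verts H) \<and>
             (\<forall>i\<in>verts H. \<forall>j\<in>verts H. {i, j} \<in> edges H \<longrightarrow> {\<phi> i, \<phi> j} \<in> edges G)}"

definition num_induced :: "'b ugraph \<Rightarrow> 'a ugraph \<Rightarrow> 'a set \<Rightarrow> nat" where
  "num_induced F G U =
     card {\<phi> \<in> verts F \<rightarrow>\<^sub>E U.
             inj_on \<phi> (verts F) \<and>
             (\<forall>i\<in>verts F. \<forall>j\<in>verts F. i \<noteq> j \<longrightarrow>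
                ({i, j} \<in> edges F \<longleftrightarrow> {\<phi> i, \<phi> j} \<in> edges G))}"

definition graph_sequence :: "(nat \<Rightarrow> 'a ugraph) \<Rightarrow> bool" where
  "graph_sequence G \<longleftrightarrow>
     (\<forall>n. simple_graph (G n)) \<and> filterlim (\<lambda>n. gorder (G n)) at_top sequentially"

text \<open>
  The test graphs \<open>H\<close> range over graphs with vertices in \<^typ>\<open>nat\<close>; every finite graph is
  isomorphic to one of these.
\<close>

definition quasi_random :: "real \<Rightarrow> (nat \<Rightarrow> 'a ugraph) \<Rightarrow> bool" where
  "quasi_random q G \<longleftrightarrow>
     graph_sequence G \<and>
     (\<forall>H :: nat ugraph. simple_graph H \<longrightarrow>
        (\<lambda>n. real (num_injhom H (G n)) - q ^ gsize H * real (gorder (G n)) ^ gorder H)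
          \<in> o(\<lambda>n. real (gorder (G n)) ^ gorder H))"

definition beta :: "'b ugraph \<Rightarrow> real \<Rightarrow> real" where
  "beta F q = q ^ gsize F * (1 - q) ^ ((gorder F choose 2) - gsize F)"

definition edge_density :: "'b ugraph \<Rightarrow> real" where
  "edge_density F = real (gsize F) / real (gorder F choose 2)"

text \<open>
  If \<open>F\<close> has neither no edges nor all edges, then \<^term>\<open>beta F\<close> is strictly increasing on
  \<open>[0, edge_density F]\<close>, strictly decreasing on \<open>[edge_density F, 1]\<close>, and zero at both
  \<open>0\<close> and \<open>1\<close>. Hence, for \<open>q\<close> in \<open>[0, 1]\<close>, the description below is of a unique number.
\<close>

definition conjugate :: "'b ugraph \<Rightarrow> real \<Rightarrow> real" where
  "conjugate F q =
     (if edges F = {} \<or> edges F = nsets (verts F) 2 \<or> q = edge_density F then q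
      else (THE r. r \<in> {0..1} \<and> r \<noteq> q \<and> beta F r = beta F q))"

definition quasi_random_pair :: "real \<Rightarrow> real \<Rightarrow> (nat \<Rightarrow> 'a ugraph) \<Rightarrow> bool" where
  "quasi_random_pair p p' G \<longleftrightarrow>
     (\<exists>I\<^sub>1 I\<^sub>2. I\<^sub>1 \<union> I\<^sub>2 = UNIV \<and> I\<^sub>1 \<inter> I\<^sub>2 = {} \<and>
        (infinite I\<^sub>1 \<longrightarrow> quasi_random p (\<lambda>n. G (enumerate I\<^sub>1 n))) \<and>
        (infinite I\<^sub>2 \<longrightarrow> quasi_random p' (\<lambda>n. G (enumerate I\<^sub>2 n))))"

text \<open>
  The uniform error term \<open>o(|G n| ^ k)\<close> is \<open>\<epsilon> n * |G n| ^ k\<close> with \<open>\<epsilon>\<close> tending to \<open>0\<close>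
  and independent of \<open>U\<close>. The bound variable \<open>G\<close> needs a fixed vertex type; \<^typ>\<open>nat\<close>
  represents all finite graphs up to isomorphism.
\<close>

definition hereditary_induced_forcing :: "'b ugraph \<Rightarrow> real \<Rightarrow> bool" where
  "hereditary_induced_forcing F p \<longleftrightarrow>
     (\<forall>G :: nat \<Rightarrow> nat ugraph.
        graph_sequence G \<longrightarrow>
        (\<exists>\<epsilon>. \<epsilon> \<longlonglongrightarrow> 0 \<and>
           (\<forall>n. \<forall>U \<subseteq> verts (G n).
              \<bar>real (num_induced F (G n) U) - beta F p * real (card U) ^ gorder F\<bar>
                \<le> \<epsilon> n * real (gorder (G n)) ^ gorder F)) \<longrightarrow>
        quasi_random_pair p (conjugate F p) G)"

end

theory Submission
  imports Defs "HOL-Computational_Algebra.Polynomial" "HOL-Real_Asymp.Real_Asymp"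
begin

text \<open>
  Choose a random set \<open>W\<close> of vertices by including each vertex \<open>v\<close> independently with probability
  \<open>x v\<close>, where the \<open>x v\<close> sum to \<open>\<gamma> N\<close> and \<open>N\<close> is the number of vertices. The size of \<open>W\<close> deviates
  from \<open>\<gamma> N\<close> by \<open>O(sqrt N)\<close> on average, and changing \<open>W\<close> by one vertex changes the number of
  induced copies of \<open>F\<close> in \<open>W\<close> by \<open>O(N ^ (k - 1))\<close>; hence the expected number of copies in \<open>W\<close> is
  \<open>\<beta> (\<gamma> N) ^ k + o(N ^ k)\<close>. This expectation is a homogeneous polynomial in \<open>x\<close>, so scaling removes the
  constraint on the sum. Taking \<open>x\<close> proportional to \<open>t\<close> on a given set \<open>U\<close> and to \<open>1\<close> off \<open>U\<close>, one
  finds that a polynomial in \<open>t\<close> of degree at most \<open>k\<close>, whose coefficient of \<open>t ^ k\<close> is the number of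
  copies in \<open>U\<close> minus \<open>\<beta> |U| ^ k\<close>, is \<open>o(N ^ k)\<close> on \<open>[1, 1 / \<gamma>]\<close>. Therefore this coefficient is
  \<open>o(N ^ k)\<close> as well, uniformly in \<open>U\<close>.
\<close>

subsection \<open>Random vertex subsets\<close>

text \<open>This is the probability that the random set equals \<open>W\<close>. Expectations are
  finite sums over \<open>Pow V\<close>, so no probability space is needed.\<close>

definition sample_weight :: "'a set \<Rightarrow> ('a \<Rightarrow> real) \<Rightarrow> 'a set \<Rightarrow> real" where
  "sample_weight V x W = (\<Prod>v\<in>W. x v) * (\<Prod>v\<in>V - W. 1 - x v)"

lemma sample_weight_nonneg:
  assumes "W \<subseteq> V" "\<And>v. v \<in> V \<Longrightarrow> 0 \<le> x v \<and> x v \<le> 1"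
  shows "0 \<le> sample_weight V x W"
  unfolding sample_weight_def using assms
  by (intro mult_nonneg_nonneg prod_nonneg) (auto simp: subset_iff)

text \<open>Replacing the exclusion factor \<open>1 - x v\<close> by 0 on \<open>S\<close> kills
  exactly the outcomes that miss a point of \<open>S\<close>. The remaining sum factorises over
  vertices, with factor \<open>x v\<close> on \<open>S\<close> and
  \<open>x v + (1 - x v) = 1\<close> elsewhere.\<close>

lemma sum_sample_weight_superset:
  assumes "finite V" "S \<subseteq> V"
  shows "(\<Sum>W\<in>Pow V. sample_weight V x W * of_bool (S \<subseteq> W)) = (\<Prod>v\<in>S. x v)"
proof -
  define g where "g v = (if v \<in> S then 0 else 1 - x v)" for v
  have "sample_weight V x W * of_bool (S \<subseteq> W) = (\<Prod>v\<in>W. x v) * (\<Prod>v\<in>V - W. g v)"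
    if "W \<in> Pow V" for W
  proof (cases "S \<subseteq> W")
    case True
    then show ?thesis
      by (auto simp: sample_weight_def g_def intro!: prod.cong)
  next
    case False
    then have "(\<Prod>v\<in>V - W. g v) = 0"
      using assms by (intro prod_zero) (auto simp: g_def)
    with False show ?thesis by simp
  qed
  then have "(\<Sum>W\<in>Pow V. sample_weight V x W * of_bool (S \<subseteq> W))
      = (\<Sum>W\<in>Pow V. (\<Prod>v\<in>W. x v) * (\<Prod>v\<in>V - W. g v))"
    by (rule sum.cong[OF refl])
  also have "\<dots> = (\<Prod>v\<in>V. x v + g v)"
    using assms(1) by (rule prod_add[symmetric])
  also have "\<dots> = (\<Prod>v\<in>S. x v)"
    using assms by (intro prod.mono_neutral_cong_right) (auto simp: g_def)
  finally show ?thesis .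
qed

lemma sum_sample_weight:
  assumes "finite V"
  shows "(\<Sum>W\<in>Pow V. sample_weight V x W) = 1"
  using sum_sample_weight_superset[OF assms, of "{}" x] by simp

text \<open>Linearity of expectation: the count is a sum of indicators of the events
  \<open>S i \<subseteq> W\<close>. Indexing by \<open>J\<close> lets equal sets count with
  multiplicity.\<close>

lemma sum_sample_weight_count:
  assumes "finite V" "\<And>i. i \<in> J \<Longrightarrow> S i \<subseteq> V" "finite J"
  shows "(\<Sum>W\<in>Pow V. sample_weight V x W * real (card {i\<in>J. S i \<subseteq> W}))
       = (\<Sum>i\<in>J. \<Prod>v\<in>S i. x v)"
proof -
  have "real (card {i\<in>J. S i \<subseteq> W}) = (\<Sum>i\<in>J. of_bool (S i \<subseteq> W))" for W
    using assms(3) by (simp add: of_bool_def sum.If_cases Int_def)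
  then have "(\<Sum>W\<in>Pow V. sample_weight V x W * real (card {i\<in>J. S i \<subseteq> W}))
      = (\<Sum>W\<in>Pow V. \<Sum>i\<in>J. sample_weight V x W * of_bool (S i \<subseteq> W))"
    by (simp add: sum_distrib_left)
  also have "\<dots> = (\<Sum>i\<in>J. \<Sum>W\<in>Pow V. sample_weight V x W * of_bool (S i \<subseteq> W))"
    by (rule sum.swap)
  also have "\<dots> = (\<Sum>i\<in>J. \<Prod>v\<in>S i. x v)"
    using assms by (intro sum.cong refl sum_sample_weight_superset) auto
  finally show ?thesis .
qed

lemma sum_sample_weight_card:
  assumes "finite V"
  shows "(\<Sum>W\<in>Pow V. sample_weight V x W * real (card W)) = (\<Sum>v\<in>V. x v)"
proof -
  have "{v\<in>V. {v} \<subseteq> W} = W" if "W \<in> Pow V" for W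
    using that by auto
  with sum_sample_weight_count[OF assms, of V "\<lambda>v. {v}" x] assms
  show ?thesis by simp
qed

text \<open>The squared size counts ordered pairs from \<open>W\<close>, that is, index sets
  \<open>{fst u, snd u}\<close>. A diagonal pair collapses to a singleton and contributes
  \<open>x v\<close> instead of its square; these differences add up to the variance.\<close>

lemma sum_sample_weight_card_squared:
  assumes "finite V"
  shows "(\<Sum>W\<in>Pow V. sample_weight V x W * (real (card W))\<^sup>2)
       = (\<Sum>v\<in>V. x v)\<^sup>2 + (\<Sum>v\<in>V. x v - (x v)\<^sup>2)"
proof -
  have W: "{u\<in>V \<times> V. {fst u, snd u} \<subseteq> W} = W \<times> W" if "W \<in> Pow V" for W
    using that by auto
  have "(\<Sum>W\<in>Pow V. sample_weight V x W * (real (card W))\<^sup>2)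
      = (\<Sum>W\<in>Pow V. sample_weight V x W * real (card {u\<in>V \<times> V. {fst u, snd u} \<subseteq> W}))"
    by (intro sum.cong refl, subst W) (auto simp: card_cartesian_product power2_eq_square)
  also have "\<dots> = (\<Sum>u\<in>V \<times> V. \<Prod>v\<in>{fst u, snd u}. x v)"
    using assms by (intro sum_sample_weight_count) auto
  also have "\<dots> = (\<Sum>v\<in>V. \<Sum>w\<in>V. \<Prod>v\<in>{v, w}. x v)"
    by (simp add: sum.cartesian_product case_prod_beta)
  also have "\<dots> = (\<Sum>v\<in>V. \<Sum>w\<in>V. x v * x w + (if w = v then x v - (x v)\<^sup>2 else 0))"
    by (intro sum.cong refl) (auto simp: power2_eq_square)
  also have "\<dots> = (\<Sum>v\<in>V. x v)\<^sup>2 + (\<Sum>v\<in>V. x v - (x v)\<^sup>2)"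
    using assms by (simp add: sum.distrib power2_eq_square sum_product)
  finally show ?thesis .
qed

text \<open>The variance is at most \<open>card V\<close>, and AM-GM passes from the second moment
  to the first. The empty set is separate because the argument divides by
  \<open>s = sqrt (card V)\<close>.\<close>

lemma sum_sample_weight_deviation:
  assumes "finite V" "\<And>v. v \<in> V \<Longrightarrow> 0 \<le> x v \<and> x v \<le> 1"
  shows "(\<Sum>W\<in>Pow V. sample_weight V x W * \<bar>real (card W) - (\<Sum>v\<in>V. x v)\<bar>) \<le> sqrt (card V)"
proof (cases "V = {}")
  case False
  define \<mu> where "\<mu> = (\<Sum>v\<in>V. x v)"
  define s where "s = sqrt (card V)"
  have s: "s > 0" "s\<^sup>2 = card V"
    using False assms(1) by (auto simp: s_def card_gt_0_iff)
  have "(\<Sum>v\<in>V. x v - (x v)\<^sup>2) \<le> (\<Sum>v\<in>V. 1)"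
    using assms(2) by (intro sum_mono) (simp add: add_increasing2 diff_le_eq)
  then have var: "(\<Sum>v\<in>V. x v - (x v)\<^sup>2) \<le> s\<^sup>2" by (simp add: s)
  have "2 * s * (\<Sum>W\<in>Pow V. sample_weight V x W * \<bar>real (card W) - \<mu>\<bar>)
      = (\<Sum>W\<in>Pow V. sample_weight V x W * (2 * s * \<bar>real (card W) - \<mu>\<bar>))"
    by (simp add: sum_distrib_left mult_ac)
  \<comment> \<open>AM-GM: \<open>2 s \<bar>d\<bar> \<le> s\<^sup>2 + d\<^sup>2\<close>\<close>
  also have "\<dots> \<le> (\<Sum>W\<in>Pow V. sample_weight V x W * (s\<^sup>2 + (real (card W) - \<mu>)\<^sup>2))"
  proof (intro sum_mono mult_left_mono)
    fix W
    show "2 * s * \<bar>real (card W) - \<mu>\<bar> \<le> s\<^sup>2 + (real (card W) - \<mu>)\<^sup>2"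
      using zero_le_power2[of "s - \<bar>real (card W) - \<mu>\<bar>"] by (simp add: power2_diff)
  qed (use assms(2) in \<open>auto intro!: sample_weight_nonneg\<close>)
  also have "\<dots> = (\<Sum>W\<in>Pow V. s\<^sup>2 * sample_weight V x W + sample_weight V x W * (real (card W))\<^sup>2
      - 2 * \<mu> * (sample_weight V x W * real (card W)) + \<mu>\<^sup>2 * sample_weight V x W)"
    by (simp add: algebra_simps power2_diff)
  also have "\<dots> = s\<^sup>2 + (\<Sum>v\<in>V. x v - (x v)\<^sup>2)"
    using assms(1)
    by (simp add: sum.distrib sum_subtractf sum_sample_weight sum_sample_weight_card
        sum_sample_weight_card_squared flip: sum_distrib_left \<mu>_def)
       (simp add: power2_eq_square)
  also have "\<dots> \<le> 2 * s * s"
    using var by (simp add: power2_eq_square)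
  finally have "2 * s * (\<Sum>W\<in>Pow V. sample_weight V x W * \<bar>real (card W) - \<mu>\<bar>) \<le> 2 * s * s" .
  then show ?thesis
    using s(1) unfolding \<mu>_def s_def[symmetric] by (simp only: mult_le_cancel_left_pos)
qed (auto simp: sample_weight_def)

section \<open>Counting index sets inside a random vertex set\<close>

text \<open>An index set inside \<open>B\<close> but not inside \<open>A\<close> contains a vertex
  of \<open>B - A\<close>, and at most \<open>D\<close> index sets pass through each such
  vertex.\<close>

lemma card_count_diff_le:
  assumes "finite J" "A \<subseteq> B" "finite B"
    and "\<And>v. v \<in> B \<Longrightarrow> real (card {i\<in>J. v \<in> S i}) \<le> D"
  shows "\<bar>real (card {i\<in>J. S i \<subseteq> B}) - real (card {i\<in>J. S i \<subseteq> A})\<bar> \<le> D * real (card B - card A)"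
proof -
  have sub: "{i\<in>J. S i \<subseteq> A} \<subseteq> {i\<in>J. S i \<subseteq> B}"
    using assms(2) by auto
  have "real (card {i\<in>J. S i \<subseteq> B}) - real (card {i\<in>J. S i \<subseteq> A})
      = real (card ({i\<in>J. S i \<subseteq> B} - {i\<in>J. S i \<subseteq> A}))"
    using assms(1) sub by (simp add: card_Diff_subset card_mono of_nat_diff)
  also have "\<dots> \<le> real (card (\<Union>v\<in>B - A. {i\<in>J. v \<in> S i}))"
    using assms by (intro of_nat_mono card_mono) auto
  also have "\<dots> \<le> real (\<Sum>v\<in>B - A. card {i\<in>J. v \<in> S i})"
    using assms by (intro of_nat_mono card_UN_le) auto
  also have "\<dots> \<le> (\<Sum>v\<in>B - A. D)"
    unfolding of_nat_sum using assms(4) by (intro sum_mono) auto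
  also have "\<dots> = D * real (card B - card A)"
    using assms by (simp add: card_Diff_subset finite_subset)
  finally show ?thesis
    using card_mono[OF _ sub] assms(1) by simp
qed

text \<open>Information on sets of size exactly \<open>m\<close> controls the expected count: a
  random set differs from some \<open>m\<close>-set in few vertices on average, and each vertex
  changes the count by at most \<open>D\<close>.\<close>

lemma expected_count_close:
  assumes "finite V" "finite J" "\<And>i. i \<in> J \<Longrightarrow> S i \<subseteq> V"
    and D: "\<And>v. v \<in> V \<Longrightarrow> real (card {i\<in>J. v \<in> S i}) \<le> D" "0 \<le> D"
    and m: "m \<le> card V"
    and close: "\<And>W. W \<subseteq> V \<Longrightarrow> card W = m \<Longrightarrow> \<bar>real (card {i\<in>J. S i \<subseteq> W}) - b\<bar> \<le> e"
    and x: "\<And>v. v \<in> V \<Longrightarrow> 0 \<le> x v \<and> x v \<le> 1"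
  shows "\<bar>(\<Sum>i\<in>J. \<Prod>v\<in>S i. x v) - b\<bar>
    \<le> e + D * (sqrt (card V) + \<bar>(\<Sum>v\<in>V. x v) - real m\<bar>)"
proof -
  define \<mu> where "\<mu> = (\<Sum>v\<in>V. x v)"
  let ?c = "\<lambda>W. real (card {i\<in>J. S i \<subseteq> W})"
  have pt: "\<bar>?c W - b\<bar> \<le> e + D * \<bar>\<mu> - real m\<bar> + D * \<bar>real (card W) - \<mu>\<bar>" if W: "W \<subseteq> V" for W
  proof -
    \<comment> \<open>\<open>W'\<close> arises from \<open>W\<close> by only deleting or only adding
      vertices, so the two sets are nested and differ in \<open>\<bar>card W - m\<bar>\<close>
      vertices.\<close>
    have "\<exists>W'\<subseteq>V. card W' = m \<and> \<bar>?c W - ?c W'\<bar> \<le> D * \<bar>real (card W) - real m\<bar>"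
    proof (cases "m \<le> card W")
      case True
      then obtain W' where W': "W' \<subseteq> W" "card W' = m"
        using obtain_subset_with_card_n by metis
      have "\<bar>?c W - ?c W'\<bar> \<le> D * real (card W - card W')"
        using W W'(1) assms by (intro card_count_diff_le) (auto intro: finite_subset)
      with True W W' show ?thesis by (intro exI[of _ W']) (auto simp: of_nat_diff)
    next
      case False
      then obtain W' where W': "W \<subseteq> W'" "W' \<subseteq> V" "card W' = m"
        using exists_subset_between[of W m V] W m assms(1) by auto
      have "\<bar>?c W' - ?c W\<bar> \<le> D * real (card W' - card W)"
        using W W'(1,2) assms by (intro card_count_diff_le) (auto intro: finite_subset)
      with False W W' show ?thesis by (intro exI[of _ W']) (auto simp: of_nat_diff abs_minus_commute)
    qed
    then obtain W' where W': "W' \<subseteq> V" "card W' = m"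
      "\<bar>?c W - ?c W'\<bar> \<le> D * \<bar>real (card W) - real m\<bar>" by blast
    have "D * \<bar>real (card W) - real m\<bar> \<le> D * (\<bar>\<mu> - real m\<bar> + \<bar>real (card W) - \<mu>\<bar>)"
      using D(2) by (intro mult_left_mono) auto
    with W' close[OF W'(1,2)] show ?thesis by (simp add: distrib_left)
  qed
  \<comment> \<open>The weights sum to 1, so the constant \<open>b\<close> moves inside the
    expectation.\<close>
  have "(\<Sum>i\<in>J. \<Prod>v\<in>S i. x v) - b = (\<Sum>W\<in>Pow V. sample_weight V x W * (?c W - b))"
    using assms(1-3)
    by (simp add: right_diff_distrib sum_subtractf sum_sample_weight_count sum_sample_weight
        flip: sum_distrib_right)
  also have "\<bar>\<dots>\<bar> \<le> (\<Sum>W\<in>Pow V. \<bar>sample_weight V x W * (?c W - b)\<bar>)"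
    by (rule sum_abs)
  also have "\<dots> \<le> (\<Sum>W\<in>Pow V. sample_weight V x W
      * (e + D * \<bar>\<mu> - real m\<bar> + D * \<bar>real (card W) - \<mu>\<bar>))"
    using x by (intro sum_mono) (auto simp: abs_mult sample_weight_nonneg pt intro!: mult_left_mono)
  also have "\<dots> = (e + D * \<bar>\<mu> - real m\<bar>) * (\<Sum>W\<in>Pow V. sample_weight V x W)
      + D * (\<Sum>W\<in>Pow V. sample_weight V x W * \<bar>real (card W) - \<mu>\<bar>)"
    by (simp add: sum_distrib_left distrib_left sum.distrib mult_ac)
  also have "\<dots> \<le> (e + D * \<bar>\<mu> - real m\<bar>) * 1 + D * sqrt (card V)"
    unfolding \<mu>_def sum_sample_weight[OF assms(1)] using assms(1) x D(2)
    by (intro add_mono mult_left_mono sum_sample_weight_deviation order_refl) auto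
  finally show ?thesis by (simp add: \<mu>_def distrib_left)
qed

subsection \<open>Polynomials small on an interval\<close>

text \<open>Induction on \<open>k\<close>: dividing \<open>p - p(a)\<close> by \<open>t - a\<close>
  lowers the degree and keeps the top coefficient. The quotient is bounded only away from
  \<open>a\<close>, so the left half of the interval is given up each time; hence \<open>a\<close>
  varies in the induction. The constant depends on \<open>a\<close>, \<open>b\<close> and
  \<open>k\<close> alone.\<close>

lemma leading_coeff_bound:
  fixes a b :: real
  assumes "a < b"
  shows "\<exists>C. \<forall>p M. degree p \<le> k \<longrightarrow> (\<forall>t\<in>{a..b}. \<bar>poly p t\<bar> \<le> M) \<longrightarrow> \<bar>coeff p k\<bar> \<le> C * M"
  using assms
proof (induction k arbitrary: a)
  case 0
  have "\<bar>coeff p 0\<bar> \<le> 1 * M" if p: "degree p \<le> 0" "\<forall>t\<in>{a..b}. \<bar>poly p t\<bar> \<le> M" for p :: "real poly" and M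
  proof -
    obtain c where "p = [:c:]" using p(1) degree_eq_zeroE[of p] by auto
    then show ?thesis using p(2) 0 by force
  qed
  then show ?case by blast
next
  case (Suc k)
  define h where "h = (b - a) / 2"
  have h: "h > 0" "a + h < b" using Suc.prems by (auto simp: h_def field_simps)
  from Suc.IH[OF h(2)] obtain C where C:
    "\<And>p M. degree p \<le> k \<Longrightarrow> (\<forall>t\<in>{a + h..b}. \<bar>poly p t\<bar> \<le> M) \<Longrightarrow> \<bar>coeff p k\<bar> \<le> C * M"
    by blast
  have "\<bar>coeff p (Suc k)\<bar> \<le> (C * 2 / h) * M"
    if p: "degree p \<le> Suc k" "\<forall>t\<in>{a..b}. \<bar>poly p t\<bar> \<le> M" for p M
  proof -
    define r where "r = synthetic_div p a"
    have r: "degree r \<le> k" using p(1) by (simp add: r_def degree_synthetic_div)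
    have eq: "p = [:-a, 1:] * r + [:poly p a:]"
      by (simp add: r_def synthetic_div_correct' del: mult_pCons_left)
    have "\<bar>poly r t\<bar> \<le> 2 * M / h" if t: "t \<in> {a + h..b}" for t
    proof -
      have "poly p t = (t - a) * poly r t + poly p a"
        by (subst eq) (simp add: algebra_simps)
      then have "(t - a) * \<bar>poly r t\<bar> = \<bar>poly p t - poly p a\<bar>"
        using t h by (simp add: abs_mult)
      also have "\<dots> \<le> 2 * M"
        using p(2)[rule_format, of t] p(2)[rule_format, of a] t h Suc.prems by auto
      finally have "(t - a) * \<bar>poly r t\<bar> \<le> 2 * M" .
      moreover have "h * \<bar>poly r t\<bar> \<le> (t - a) * \<bar>poly r t\<bar>"
        using t by (intro mult_right_mono) auto
      ultimately show ?thesis using h(1) by (simp add: field_simps)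
    qed
    then have "\<bar>coeff r k\<bar> \<le> C * (2 * M / h)" using C[OF r] by blast
    \<comment> \<open>The factor \<open>[:-a, 1:]\<close> is monic, and
      \<open>coeff r (Suc k)\<close> vanishes because \<open>degree r \<le> k\<close>.\<close>
    moreover have "coeff p (Suc k) = coeff r k"
      using r by (subst eq) (simp add: coeff_eq_0)
    ultimately show ?thesis by (simp add: mult_ac)
  qed
  then show ?case by blast
qed

subsection \<open>From sets of one size to all sets\<close>

text \<open>After scaling to \<open>[0, 1]\<close>, the \<open>k\<close>-th power is Lipschitz with
  constant \<open>k\<close>. Writing \<open>N ^ k / N\<close> avoids the truncated exponent
  \<open>k - 1\<close>.\<close>

lemma power_diff_le:
  fixes a b N :: real
  assumes "0 \<le> a" "a \<le> N" "0 \<le> b" "b \<le> N" "0 < N"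
  shows "\<bar>a ^ k - b ^ k\<bar> \<le> real k * N ^ k / N * \<bar>a - b\<bar>"
proof -
  have "norm ((a / N) ^ k - (b / N) ^ k) \<le> real k * norm (a / N - b / N)"
    using assms by (intro norm_power_diff) auto
  then have "N ^ k * \<bar>(a / N) ^ k - (b / N) ^ k\<bar> \<le> N ^ k * (real k * \<bar>a / N - b / N\<bar>)"
    unfolding real_norm_def using assms(5) by (intro mult_left_mono) auto
  also have "\<bar>a / N - b / N\<bar> = \<bar>a - b\<bar> / N"
    using assms(5) by (simp add: abs_divide flip: diff_divide_distrib)
  also have "N ^ k * \<bar>(a / N) ^ k - (b / N) ^ k\<bar> = \<bar>a ^ k - b ^ k\<bar>"
    using assms(5) by (simp add: power_divide abs_divide flip: diff_divide_distrib)
  finally show ?thesis by (simp add: mult.commute mult.left_commute)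
qed

text \<open>Vertices of \<open>U\<close> get probability \<open>c * t\<close>, all others
  \<open>c\<close>. As every index set has \<open>k\<close> elements, the expected count is
  \<open>c ^ k\<close> times the sum over \<open>J\<close>; dividing by \<open>c ^ k\<close> costs
  at most the factor \<open>1 / \<gamma> ^ (2 * k)\<close>.\<close>

lemma count_polynomial_close:
  fixes \<gamma> \<beta> e t :: real
  assumes "finite V" "V \<noteq> {}" "finite J"
    and S: "\<And>i. i \<in> J \<Longrightarrow> S i \<subseteq> V" "\<And>i. i \<in> J \<Longrightarrow> card (S i) = k"
    and D: "\<And>v. v \<in> V \<Longrightarrow> real (card {i\<in>J. v \<in> S i}) \<le> real k * real (card V) ^ k / card V"
    and \<gamma>: "0 < \<gamma>" "\<gamma> < 1" and \<beta>: "0 \<le> \<beta>" "\<beta> \<le> 1"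
    and close: "\<And>W. W \<subseteq> V \<Longrightarrow> int (card W) = \<lfloor>\<gamma> * real (card V)\<rfloor> \<Longrightarrow>
      \<bar>real (card {i\<in>J. S i \<subseteq> W}) - \<beta> * real (card W) ^ k\<bar> \<le> e * real (card V) ^ k"
    and U: "U \<subseteq> V" and t: "1 \<le> t" "t \<le> 1 / \<gamma>"
  shows "\<bar>(\<Sum>i\<in>J. t ^ card (S i \<inter> U)) - \<beta> * (card V - card U + t * card U) ^ k\<bar>
    \<le> (e + real k * (sqrt (card V) + 2) / card V) * real (card V) ^ k / \<gamma> ^ (2 * k)"
proof -
  define N where "N = real (card V)"
  define D where "D = real k * N ^ k / N"
  define m where "m = nat \<lfloor>\<gamma> * N\<rfloor>"
  define s where "s = real (card V - card U) + t * card U"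
  \<comment> \<open>The normalisation that makes the probabilities sum to
    \<open>\<gamma> * N\<close>, since the unnormalised weights sum to \<open>s\<close>.\<close>
  define c where "c = \<gamma> * N / s"
  define q where "q = (\<Sum>i\<in>J. t ^ card (S i \<inter> U))"
  have N: "N > 0" using assms(1,2) by (simp add: N_def card_gt_0_iff)
  have u: "card U \<le> card V" using assms(1) U card_mono by blast
  have sN: "N \<le> s" "s \<le> t * N"
  proof -
    have "1 * real (card U) \<le> t * real (card U)" using t by (intro mult_right_mono) auto
    moreover have "1 * (N - real (card U)) \<le> t * (N - real (card U))"
      using t u by (intro mult_right_mono) (auto simp: N_def)
    ultimately show "N \<le> s" "s \<le> t * N"
      using u by (auto simp: s_def N_def of_nat_diff algebra_simps)
  qed
  have s: "s > 0" using sN N by linarith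
  have c: "c > 0" "c * s = \<gamma> * N" using \<gamma> N s by (auto simp: c_def)
  \<comment> \<open>Here the upper limit \<open>1 / \<gamma>\<close> for \<open>t\<close> is what
    keeps the probabilities on \<open>U\<close> at most 1.\<close>
  have ct: "c * t \<le> 1"
  proof -
    have "\<gamma> * t \<le> 1" using t \<gamma> by (simp add: field_simps)
    then have "N * (\<gamma> * t) \<le> N * 1" using N by (intro mult_left_mono) auto
    with sN have "\<gamma> * N * t \<le> s" by (simp add: mult_ac)
    then show ?thesis using s by (simp add: c_def)
  qed
  have "c * 1 \<le> c * t" using t c by (intro mult_left_mono) auto
  then have c1: "c \<le> 1" using ct by linarith
  \<comment> \<open>From \<open>s \<le> t * N \<le> N / \<gamma>\<close>.\<close>
  have c2: "\<gamma>\<^sup>2 \<le> c"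
  proof -
    have "s * \<gamma> \<le> t * \<gamma> * N" using sN \<gamma> by (simp add: mult_ac mult_left_mono)
    also have "\<dots> \<le> 1 * N" using t \<gamma> N by (intro mult_right_mono) (auto simp: field_simps)
    finally have "\<gamma> * (s * \<gamma>) \<le> \<gamma> * N" using \<gamma> by simp
    then show ?thesis using s by (simp add: c_def field_simps power2_eq_square)
  qed
  define x where "x v = c * (if v \<in> U then t else 1)" for v
  have x: "0 \<le> x v \<and> x v \<le> 1" for v using c c1 ct t by (auto simp: x_def)
  have sumx: "(\<Sum>v\<in>V. x v) = \<gamma> * N"
  proof -
    have "(\<Sum>v\<in>V. x v) = c * (\<Sum>v\<in>V. if v \<in> U then t else 1)"
      by (simp add: x_def sum_distrib_left)
    also have "(\<Sum>v\<in>V. if v \<in> U then t else 1) = s"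
      using assms(1) U
      by (simp add: sum.If_cases Int_absorb1 Diff_eq[symmetric] card_Diff_subset finite_subset s_def)
    finally show ?thesis by (simp add: c)
  qed
  have prodx: "(\<Prod>v\<in>S i. x v) = c ^ k * t ^ card (S i \<inter> U)" if "i \<in> J" for i
  proof -
    have "finite (S i)" using S(1)[OF that] assms(1) finite_subset by blast
    then show ?thesis using S(2)[OF that]
      by (simp add: x_def prod.distrib prod.If_cases)
  qed
  have m: "real m \<le> \<gamma> * N" "\<gamma> * N - 1 \<le> real m" "int m = \<lfloor>\<gamma> * N\<rfloor>" "real m \<ge> 0"
    using \<gamma> N by (auto simp: m_def)
  have gN: "\<gamma> * N \<le> N" using \<gamma> N by simp
  have D0: "D \<ge> 0" using N by (simp add: D_def)
  have "\<bar>(\<Sum>i\<in>J. \<Prod>v\<in>S i. x v) - \<beta> * real m ^ k\<bar>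
      \<le> e * N ^ k + D * (sqrt (card V) + \<bar>(\<Sum>v\<in>V. x v) - real m\<bar>)"
  proof (rule expected_count_close[OF assms(1,3) S(1)])
    show "real (card {i \<in> J. v \<in> S i}) \<le> D" if "v \<in> V" for v
      using assms(6)[OF that] by (simp add: D_def N_def)
    show "m \<le> card V" using m(1) gN by (simp add: N_def)
    show "\<bar>real (card {i \<in> J. S i \<subseteq> W}) - \<beta> * real m ^ k\<bar> \<le> e * N ^ k"
      if "W \<subseteq> V" "card W = m" for W
      using close[of W] that m(3) by (simp add: N_def)
  qed (use D0 x in auto)
  also have "\<dots> \<le> e * N ^ k + D * (sqrt (card V) + 1)"
    using m D0 by (intro add_left_mono mult_left_mono) (auto simp: sumx)
  finally have 1: "\<bar>c ^ k * q - \<beta> * real m ^ k\<bar> \<le> e * N ^ k + D * (sqrt (card V) + 1)"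
    by (simp add: prodx q_def sum_distrib_left)
  \<comment> \<open>Rounding \<open>\<gamma> * N\<close> down to \<open>m\<close> enters twice, each
    time at cost at most \<open>D\<close>: in the deviation of the size above, and here in the main
    term. Together they give the summand 2 beside the square root.\<close>
  have "\<bar>real m ^ k - (\<gamma> * N) ^ k\<bar> \<le> D * \<bar>real m - \<gamma> * N\<bar>"
    unfolding D_def using order_trans[OF m(1) gN] gN N \<gamma> by (intro power_diff_le) auto
  also have "\<dots> \<le> D * 1" using m D0 by (intro mult_left_mono) auto
  finally have "\<beta> * \<bar>real m ^ k - (\<gamma> * N) ^ k\<bar> \<le> 1 * D"
    using \<beta> D0 by (intro mult_mono) auto
  then have 2: "\<bar>\<beta> * real m ^ k - \<beta> * (\<gamma> * N) ^ k\<bar> \<le> D"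
    using \<beta> by (simp add: abs_mult flip: right_diff_distrib)
  define R where "R = e * N ^ k + D * (sqrt (card V) + 2)"
  have 3: "\<bar>c ^ k * q - \<beta> * (\<gamma> * N) ^ k\<bar> \<le> R"
    using 1 2 by (simp add: R_def distrib_left)
  have "(\<gamma> ^ (2 * k)) * \<bar>q - \<beta> * s ^ k\<bar> \<le> c ^ k * \<bar>q - \<beta> * s ^ k\<bar>"
    unfolding power_mult using c2 by (intro mult_right_mono power_mono) auto
  also have "\<dots> = \<bar>c ^ k * q - \<beta> * (\<gamma> * N) ^ k\<bar>"
  proof -
    have "c ^ k * (q - \<beta> * s ^ k) = c ^ k * q - \<beta> * (\<gamma> * N) ^ k"
      unfolding c(2)[symmetric] by (simp add: algebra_simps power_mult_distrib)
    then show ?thesis using c(1) by (simp add: abs_mult flip: \<open>_ = c ^ k * q - _\<close>)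
  qed
  also have "\<dots> \<le> R" by (rule 3)
  finally have "\<bar>q - \<beta> * s ^ k\<bar> \<le> R / \<gamma> ^ (2 * k)"
    using \<gamma> by (simp add: field_simps)
  moreover have "R = (e + real k * (sqrt (card V) + 2) / N) * N ^ k"
    by (simp add: R_def D_def algebra_simps)
  ultimately show ?thesis using u by (simp add: q_def s_def N_def of_nat_diff)
qed

text \<open>The constant is fixed before \<open>V\<close>, \<open>J\<close>, \<open>S\<close>,
  \<open>\<beta>\<close>, \<open>e\<close> and \<open>U\<close>, which gives the uniformity over all
  graphs and all subsets.\<close>

lemma count_all_subsets_close:
  fixes \<gamma> :: real
  assumes "0 < \<gamma>" "\<gamma> < 1"
  obtains C where "\<And>V J (S :: 'i \<Rightarrow> 'a set) \<beta> e U.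
    \<lbrakk>finite V; V \<noteq> {}; finite J; \<And>i. i \<in> J \<Longrightarrow> S i \<subseteq> V; \<And>i. i \<in> J \<Longrightarrow> card (S i) = k;
      \<And>v. v \<in> V \<Longrightarrow> real (card {i\<in>J. v \<in> S i}) \<le> real k * real (card V) ^ k / card V;
      0 \<le> \<beta>; \<beta> \<le> 1;
      \<And>W. W \<subseteq> V \<Longrightarrow> int (card W) = \<lfloor>\<gamma> * real (card V)\<rfloor> \<Longrightarrow>
        \<bar>real (card {i\<in>J. S i \<subseteq> W}) - \<beta> * real (card W) ^ k\<bar> \<le> e * real (card V) ^ k;
      U \<subseteq> V\<rbrakk> \<Longrightarrow>
    \<bar>real (card {i\<in>J. S i \<subseteq> U}) - \<beta> * real (card U) ^ k\<bar>
      \<le> C * (e + real k * (sqrt (card V) + 2) / card V) * real (card V) ^ k"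
proof -
  obtain C where C:
    "\<And>p M. degree p \<le> k \<Longrightarrow> (\<forall>t\<in>{1..1 / \<gamma>}. \<bar>poly p t\<bar> \<le> M) \<Longrightarrow> \<bar>coeff p k\<bar> \<le> C * M"
    using leading_coeff_bound[of 1 "1 / \<gamma>" k] assms by auto
  show ?thesis
  proof (rule that[of "C / \<gamma> ^ (2 * k)"])
    fix V :: "'a set" and J and S :: "'i \<Rightarrow> 'a set" and \<beta> e :: real and U
    assume fin: "finite V" "V \<noteq> {}" "finite J"
      and S: "\<And>i. i \<in> J \<Longrightarrow> S i \<subseteq> V" "\<And>i. i \<in> J \<Longrightarrow> card (S i) = k"
      and D: "\<And>v. v \<in> V \<Longrightarrow> real (card {i\<in>J. v \<in> S i}) \<le> real k * real (card V) ^ k / card V"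
      and \<beta>: "0 \<le> \<beta>" "\<beta> \<le> 1"
      and close: "\<And>W. W \<subseteq> V \<Longrightarrow> int (card W) = \<lfloor>\<gamma> * real (card V)\<rfloor> \<Longrightarrow>
        \<bar>real (card {i\<in>J. S i \<subseteq> W}) - \<beta> * real (card W) ^ k\<bar> \<le> e * real (card V) ^ k"
      and U: "U \<subseteq> V"
    \<comment> \<open>An index set contributes to the coefficient of \<open>t ^ k\<close> only if
      all its \<open>k\<close> points lie in \<open>U\<close>. The linear polynomial is the total
      weight \<open>s\<close> of the previous lemma, and its \<open>k\<close>-th power has top
      coefficient \<open>card U ^ k\<close>.\<close>
    define p where "p = (\<Sum>i\<in>J. monom (1::real) (card (S i \<inter> U)))
      - smult \<beta> ([:real (card V - card U), real (card U):] ^ k)"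
    have le: "card (S i \<inter> U) \<le> k" and full: "card (S i \<inter> U) = k \<longleftrightarrow> S i \<subseteq> U" if "i \<in> J" for i
    proof -
      have f: "finite (S i)" and k: "card (S i) = k" using S[OF that] fin(1) finite_subset by blast+
      show "card (S i \<inter> U) \<le> k" using card_mono[OF f, of "S i \<inter> U"] k by simp
      show "card (S i \<inter> U) = k \<longleftrightarrow> S i \<subseteq> U"
        using card_subset_eq[OF f, of "S i \<inter> U"] k by (auto simp: Int_absorb2)
    qed
    have "degree p \<le> k"
      unfolding p_def
    proof (intro degree_diff_le degree_sum_le fin)
      show "degree (monom (1::real) (card (S i \<inter> U))) \<le> k" if "i \<in> J" for i
        using degree_monom_le le[OF that] order_trans by blast
      have "degree ([:real (card V - card U), real (card U):] ^ k) \<le> 1 * k"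
        by (intro order_trans[OF degree_power_le]) auto
      then show "degree (smult \<beta> ([:real (card V - card U), real (card U):] ^ k)) \<le> k"
        using degree_smult_le order_trans by fastforce
    qed
    moreover have "\<forall>t\<in>{1..1 / \<gamma>}. \<bar>poly p t\<bar>
      \<le> (e + real k * (sqrt (card V) + 2) / card V) * real (card V) ^ k / \<gamma> ^ (2 * k)"
    proof
      fix t assume t: "t \<in> {1..1 / \<gamma>}"
      have u: "card U \<le> card V" using fin U card_mono by blast
      have "poly p t = (\<Sum>i\<in>J. t ^ card (S i \<inter> U)) - \<beta> * (card V - card U + t * card U) ^ k"
        using u by (simp add: p_def poly_sum poly_monom of_nat_diff)
      also have "\<bar>\<dots>\<bar> \<le> (e + real k * (sqrt (card V) + 2) / card V) * real (card V) ^ k / \<gamma> ^ (2 * k)"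
        using t by (intro count_polynomial_close[OF fin S D assms \<beta> close U]) auto
      finally show "\<bar>poly p t\<bar> \<le> \<dots>" .
    qed
    ultimately have "\<bar>coeff p k\<bar> \<le> C * ((e + real k * (sqrt (card V) + 2) / card V) * real (card V) ^ k / \<gamma> ^ (2 * k))"
      by (rule C)
    moreover have "coeff p k = real (card {i\<in>J. S i \<subseteq> U}) - \<beta> * real (card U) ^ k"
    proof -
      have "(\<Sum>i\<in>J. coeff (monom (1::real) (card (S i \<inter> U))) k) = (\<Sum>i\<in>J. of_bool (S i \<subseteq> U))"
        by (intro sum.cong) (auto simp: full)
      also have "\<dots> = real (card {i\<in>J. S i \<subseteq> U})"
        using fin by (simp add: of_bool_def sum.If_cases Int_def)
      finally show ?thesis
        by (simp add: p_def coeff_sum coeff_linear_poly_power)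
    qed
    ultimately show "\<bar>real (card {i\<in>J. S i \<subseteq> U}) - \<beta> * real (card U) ^ k\<bar>
      \<le> C / \<gamma> ^ (2 * k) * (e + real k * (sqrt (card V) + 2) / card V) * real (card V) ^ k"
      by (simp add: mult_ac)
  qed
qed

section \<open>Induced copies as a family of vertex sets\<close>

text \<open>A union bound over the index \<open>i\<close> that is sent to \<open>v\<close>; the
  other values remain free. This supplies the degree bound \<open>D\<close> for families of
  maps.\<close>

lemma card_PiE_through_point:
  assumes "finite I" "finite V" "v \<in> V"
  shows "real (card {\<phi> \<in> I \<rightarrow>\<^sub>E V. v \<in> \<phi> ` I}) \<le> real (card I) * real (card V) ^ card I / card V"
proof -
  have fixed: "card {\<phi> \<in> I \<rightarrow>\<^sub>E V. \<phi> i = v} = card V ^ (card I - 1)" if "i \<in> I" for i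
  proof -
    have "{\<phi> \<in> I \<rightarrow>\<^sub>E V. \<phi> i = v} = (\<Pi>\<^sub>E j\<in>I. if j = i then {v} else V)"
      using that assms(3) by (auto simp: PiE_iff extensional_def split: if_splits)
    then have "card {\<phi> \<in> I \<rightarrow>\<^sub>E V. \<phi> i = v} = (\<Prod>j\<in>I. if j = i then 1 else card V)"
      using assms(1) by (simp add: card_PiE if_distrib cong: if_cong)
    also have "\<dots> = (\<Prod>j\<in>I - {i}. if j = i then 1 else card V)"
      using assms(1) that by (simp add: prod.remove[of I i])
    also have "\<dots> = card V ^ (card I - 1)"
      using assms(1) that by simp
    finally show ?thesis .
  qed
  have "card {\<phi> \<in> I \<rightarrow>\<^sub>E V. v \<in> \<phi> ` I} \<le> card (\<Union>i\<in>I. {\<phi> \<in> I \<rightarrow>\<^sub>E V. \<phi> i = v})"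
    using assms by (intro card_mono) (auto simp: finite_PiE)
  also have "\<dots> \<le> (\<Sum>i\<in>I. card {\<phi> \<in> I \<rightarrow>\<^sub>E V. \<phi> i = v})"
    using assms(1) by (rule card_UN_le)
  also have "\<dots> = card I * card V ^ (card I - 1)"
    by (simp add: fixed)
  finally have "real (card {\<phi> \<in> I \<rightarrow>\<^sub>E V. v \<in> \<phi> ` I}) \<le> real (card I * card V ^ (card I - 1))"
    by (rule of_nat_mono)
  also have "\<dots> = real (card I) * real (card V) ^ card I / card V"
  \<comment> \<open>If \<open>card I = 0\<close> the exponent \<open>card I - 1\<close> truncates,
    but the factor \<open>card I\<close> makes both sides 0.\<close>
  proof -
    have "card V \<noteq> 0" using assms by auto
    then show ?thesis by (cases "card I") (auto simp: field_simps)
  qed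
  finally show ?thesis .
qed

lemma beta_bounds:
  assumes "0 \<le> q" "q \<le> 1"
  shows "0 \<le> beta F q" "beta F q \<le> 1"
  using assms by (auto simp: beta_def intro!: mult_le_one power_le_one)

lemma num_induced_close_all_subsets:
  fixes \<gamma> :: real and F :: "'b ugraph"
  assumes "0 < \<gamma>" "\<gamma> < 1" "finite (verts F)"
  obtains C where "\<And>(G :: 'a ugraph) \<beta> e U.
    \<lbrakk>finite (verts G); verts G \<noteq> {}; 0 \<le> \<beta>; \<beta> \<le> 1;
      \<And>W. W \<subseteq> verts G \<Longrightarrow> int (card W) = \<lfloor>\<gamma> * real (gorder G)\<rfloor> \<Longrightarrow>
        \<bar>real (num_induced F G W) - \<beta> * real (card W) ^ gorder F\<bar> \<le> e * real (gorder G) ^ gorder F;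
      U \<subseteq> verts G\<rbrakk> \<Longrightarrow>
    \<bar>real (num_induced F G U) - \<beta> * real (card U) ^ gorder F\<bar>
      \<le> C * (e + real (gorder F) * (sqrt (gorder G) + 2) / gorder G) * real (gorder G) ^ gorder F"
proof -
  let ?k = "gorder F"
  define I where "I = verts F"
  have I: "finite I" "card I = ?k" using assms(3) by (auto simp: I_def)
  show ?thesis
  proof (rule count_all_subsets_close[OF assms(1,2), of ?k, where ?'i = "'b \<Rightarrow> 'a" and ?'a = 'a],
      rule that)
    fix C :: real and G :: "'a ugraph" and \<beta> e :: real and U
    assume count: "\<And>V J (S :: ('b \<Rightarrow> 'a) \<Rightarrow> 'a set) \<beta> e U.
      \<lbrakk>finite V; V \<noteq> {}; finite J; \<And>i. i \<in> J \<Longrightarrow> S i \<subseteq> V; \<And>i. i \<in> J \<Longrightarrow> card (S i) = ?k;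
        \<And>v. v \<in> V \<Longrightarrow> real (card {i\<in>J. v \<in> S i}) \<le> real ?k * real (card V) ^ ?k / card V;
        0 \<le> \<beta>; \<beta> \<le> 1;
        \<And>W. W \<subseteq> V \<Longrightarrow> int (card W) = \<lfloor>\<gamma> * real (card V)\<rfloor> \<Longrightarrow>
          \<bar>real (card {i\<in>J. S i \<subseteq> W}) - \<beta> * real (card W) ^ ?k\<bar> \<le> e * real (card V) ^ ?k;
        U \<subseteq> V\<rbrakk> \<Longrightarrow>
      \<bar>real (card {i\<in>J. S i \<subseteq> U}) - \<beta> * real (card U) ^ ?k\<bar>
        \<le> C * (e + real ?k * (sqrt (card V) + 2) / card V) * real (card V) ^ ?k"
    assume G: "finite (verts G)" "verts G \<noteq> {}" and \<beta>: "0 \<le> \<beta>" "\<beta> \<le> 1"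
      and close: "\<And>W. W \<subseteq> verts G \<Longrightarrow> int (card W) = \<lfloor>\<gamma> * real (gorder G)\<rfloor> \<Longrightarrow>
        \<bar>real (num_induced F G W) - \<beta> * real (card W) ^ ?k\<bar> \<le> e * real (gorder G) ^ ?k"
      and U: "U \<subseteq> verts G"
    \<comment> \<open>The family is indexed by the induced embeddings into the whole graph, each
      with its image as index set. Copies inside \<open>W\<close> are then exactly the members of
      \<open>J\<close> whose image lies in \<open>W\<close>.\<close>
    define J where "J = {\<phi> \<in> I \<rightarrow>\<^sub>E verts G. inj_on \<phi> I \<and>
      (\<forall>i\<in>I. \<forall>j\<in>I. i \<noteq> j \<longrightarrow> ({i, j} \<in> edges F \<longleftrightarrow> {\<phi> i, \<phi> j} \<in> edges G))}"
    have J: "J \<subseteq> I \<rightarrow>\<^sub>E verts G" by (auto simp: J_def)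
    have finE: "finite (I \<rightarrow>\<^sub>E verts G)" using I G by (simp add: finite_PiE)
    have eq: "num_induced F G W = card {\<phi> \<in> J. \<phi> ` I \<subseteq> W}" if "W \<subseteq> verts G" for W
      unfolding num_induced_def J_def I_def[symmetric]
      using that by (intro arg_cong[where f = card]) (auto simp: PiE_iff)
    have "\<bar>real (card {\<phi> \<in> J. \<phi> ` I \<subseteq> U}) - \<beta> * real (card U) ^ ?k\<bar>
      \<le> C * (e + real ?k * (sqrt (gorder G) + 2) / gorder G) * real (gorder G) ^ ?k"
    proof (rule count[OF G _ _ _ _ \<beta> _ U])
      show "finite J" using J finE finite_subset by blast
      show "\<phi> ` I \<subseteq> verts G" if "\<phi> \<in> J" for \<phi>
        using that J by auto
      show "card (\<phi> ` I) = ?k" if "\<phi> \<in> J" for \<phi>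
        using that I(2) by (auto simp: J_def card_image)
      show "real (card {\<phi> \<in> J. v \<in> \<phi> ` I}) \<le> real ?k * real (gorder G) ^ ?k / gorder G"
        if v: "v \<in> verts G" for v
      proof -
        have "card {\<phi> \<in> J. v \<in> \<phi> ` I} \<le> card {\<phi> \<in> I \<rightarrow>\<^sub>E verts G. v \<in> \<phi> ` I}"
          using J finE by (intro card_mono) auto
        then show ?thesis
          using card_PiE_through_point[OF I(1) G(1) v] I(2) by simp
      qed
      show "\<bar>real (card {\<phi> \<in> J. \<phi> ` I \<subseteq> W}) - \<beta> * real (card W) ^ ?k\<bar> \<le> e * real (gorder G) ^ ?k"
        if "W \<subseteq> verts G" "int (card W) = \<lfloor>\<gamma> * real (gorder G)\<rfloor>" for W
        using close[OF that] by (simp add: eq that(1))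
    qed
    then show "\<bar>real (num_induced F G U) - \<beta> * real (card U) ^ ?k\<bar>
      \<le> C * (e + real ?k * (sqrt (gorder G) + 2) / gorder G) * real (gorder G) ^ ?k"
      by (simp add: eq[OF U])
  qed
qed

subsection \<open>Change of vertex type\<close>

definition graph_image :: "('a \<Rightarrow> 'b) \<Rightarrow> 'a ugraph \<Rightarrow> 'b ugraph" where
  "graph_image f G = UGraph (f ` verts G) ((`) f ` edges G)"

lemma verts_graph_image [simp]: "verts (graph_image f G) = f ` verts G"
  by (simp add: graph_image_def)

lemma simple_graph_edge_subset: "simple_graph G \<Longrightarrow> edges G \<subseteq> Pow (verts G)"
  by (auto simp: simple_graph_def nsets_def)

lemma edge_graph_image_iff:
  assumes "simple_graph G" "inj_on f (verts G)" "u \<in> verts G" "v \<in> verts G"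
  shows "{f u, f v} \<in> edges (graph_image f G) \<longleftrightarrow> {u, v} \<in> edges G"
  using inj_on_image_mem_iff[OF inj_on_image_Pow[OF assms(2)], of "{u, v}" "edges G"]
    simple_graph_edge_subset[OF assms(1)] assms(3,4)
  by (simp add: graph_image_def)

lemma simple_graph_graph_image:
  assumes "simple_graph G" "inj_on f (verts G)"
  shows "simple_graph (graph_image f G)"
proof -
  have "f ` e \<in> nsets (f ` verts G) 2" if "e \<in> edges G" for e
  proof -
    have e: "e \<subseteq> verts G" "finite e" "card e = 2"
      using that assms(1) by (auto simp: simple_graph_def nsets_def)
    then show ?thesis
      using card_image[OF inj_on_subset[OF assms(2) e(1)]] by (auto simp: nsets_def)
  qed
  then show ?thesis
    using assms(1) by (auto simp: simple_graph_def graph_image_def)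
qed

text \<open>Composition with \<open>f\<close> is a bijection between the two sets of maps, with
  inverse built from \<open>inv_into\<close>; restricting to \<open>I\<close> keeps the composites
  extensional.\<close>

lemma card_PiE_image:
  assumes f: "inj_on f U"
    and PQ: "\<And>\<phi>. \<phi> \<in> I \<rightarrow>\<^sub>E U \<Longrightarrow> Q (restrict (f \<circ> \<phi>) I) \<longleftrightarrow> P \<phi>"
  shows "card {\<phi> \<in> I \<rightarrow>\<^sub>E f ` U. Q \<phi>} = card {\<phi> \<in> I \<rightarrow>\<^sub>E U. P \<phi>}"
proof -
  define h where "h \<phi> = restrict (f \<circ> \<phi>) I" for \<phi>
  have inj: "inj_on h (I \<rightarrow>\<^sub>E U)"
  proof (rule inj_onI)
    fix \<phi> \<psi> assume a: "\<phi> \<in> I \<rightarrow>\<^sub>E U" "\<psi> \<in> I \<rightarrow>\<^sub>E U" "h \<phi> = h \<psi>"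
    have "\<phi> i = \<psi> i" if "i \<in> I" for i
    proof (rule inj_onD[OF f])
      show "f (\<phi> i) = f (\<psi> i)" using fun_cong[OF a(3), of i] that by (simp add: h_def)
    qed (use a that in auto)
    then show "\<phi> = \<psi>" using a(1,2) by (rule PiE_ext[rotated 2])
  qed
  have "{\<phi> \<in> I \<rightarrow>\<^sub>E f ` U. Q \<phi>} = h ` {\<phi> \<in> I \<rightarrow>\<^sub>E U. P \<phi>}"
  proof (intro equalityI subsetI)
    fix \<psi> assume "\<psi> \<in> {\<phi> \<in> I \<rightarrow>\<^sub>E f ` U. Q \<phi>}"
    then have \<psi>: "\<psi> \<in> I \<rightarrow>\<^sub>E f ` U" "Q \<psi>" by auto
    define \<phi> where "\<phi> = restrict (inv_into U f \<circ> \<psi>) I"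
    have \<phi>: "\<phi> \<in> I \<rightarrow>\<^sub>E U"
      using \<psi>(1) by (auto simp: \<phi>_def intro!: inv_into_into PiE_mem[OF \<psi>(1)])
    have "h \<phi> = \<psi>"
    proof (rule PiE_ext[OF _ \<psi>(1)])
      show "h \<phi> \<in> I \<rightarrow>\<^sub>E f ` U" using \<phi> by (auto simp: h_def)
      show "h \<phi> i = \<psi> i" if "i \<in> I" for i
        using \<psi>(1) that by (auto simp: h_def \<phi>_def intro!: f_inv_into_f)
    qed
    then show "\<psi> \<in> h ` {\<phi> \<in> I \<rightarrow>\<^sub>E U. P \<phi>}"
      using PQ[OF \<phi>] \<phi> \<psi>(2) by (auto simp: h_def)
  next
    fix \<psi> assume "\<psi> \<in> h ` {\<phi> \<in> I \<rightarrow>\<^sub>E U. P \<phi>}"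
    then show "\<psi> \<in> {\<phi> \<in> I \<rightarrow>\<^sub>E f ` U. Q \<phi>}"
      using PQ by (auto simp: h_def)
  qed
  then show ?thesis
    using card_image[OF inj_on_subset[OF inj]] by simp
qed

lemma inj_on_restrict_comp_iff:
  assumes "inj_on f U" "\<phi> \<in> I \<rightarrow>\<^sub>E U"
  shows "inj_on (restrict (f \<circ> \<phi>) I) I \<longleftrightarrow> inj_on \<phi> I"
proof -
  have "\<phi> ` I \<subseteq> U" using assms(2) by auto
  then have "inj_on (f \<circ> \<phi>) I \<longleftrightarrow> inj_on \<phi> I"
    using comp_inj_on[of \<phi> I f] inj_on_subset[OF assms(1)] inj_on_imageI2[of f \<phi> I] by blast
  then show ?thesis by (simp add: inj_on_restrict_eq)
qed

lemma num_induced_graph_image: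
  assumes "simple_graph G" "inj_on f (verts G)" "U \<subseteq> verts G"
  shows "num_induced F (graph_image f G) (f ` U) = num_induced F G U"
  unfolding num_induced_def
proof (rule card_PiE_image)
  show "inj_on f U" using assms inj_on_subset by blast
  fix \<phi> assume \<phi>: "\<phi> \<in> verts F \<rightarrow>\<^sub>E U"
  have "\<phi> i \<in> verts G" if "i \<in> verts F" for i using \<phi> that assms(3) by auto
  then show "(inj_on (restrict (f \<circ> \<phi>) (verts F)) (verts F) \<and>
      (\<forall>i\<in>verts F. \<forall>j\<in>verts F. i \<noteq> j \<longrightarrow> ({i, j} \<in> edges F) =
        ({restrict (f \<circ> \<phi>) (verts F) i, restrict (f \<circ> \<phi>) (verts F) j} \<in> edges (graph_image f G)))) =
    (inj_on \<phi> (verts F) \<and>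
      (\<forall>i\<in>verts F. \<forall>j\<in>verts F. i \<noteq> j \<longrightarrow> ({i, j} \<in> edges F) = ({\<phi> i, \<phi> j} \<in> edges G)))"
    using inj_on_restrict_comp_iff[OF \<open>inj_on f U\<close> \<phi>]
    by (simp add: edge_graph_image_iff[OF assms(1,2)])
qed

lemma num_injhom_graph_image:
  assumes "simple_graph G" "inj_on f (verts G)"
  shows "num_injhom H (graph_image f G) = num_injhom H G"
  unfolding num_injhom_def verts_graph_image
proof (rule card_PiE_image[OF assms(2)])
  fix \<phi> assume \<phi>: "\<phi> \<in> verts H \<rightarrow>\<^sub>E verts G"
  have "\<phi> i \<in> verts G" if "i \<in> verts H" for i using \<phi> that by auto
  then show "(inj_on (restrict (f \<circ> \<phi>) (verts H)) (verts H) \<and>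
      (\<forall>i\<in>verts H. \<forall>j\<in>verts H. {i, j} \<in> edges H \<longrightarrow>
        {restrict (f \<circ> \<phi>) (verts H) i, restrict (f \<circ> \<phi>) (verts H) j} \<in> edges (graph_image f G))) =
    (inj_on \<phi> (verts H) \<and>
      (\<forall>i\<in>verts H. \<forall>j\<in>verts H. {i, j} \<in> edges H \<longrightarrow> {\<phi> i, \<phi> j} \<in> edges G))"
    using inj_on_restrict_comp_iff[OF assms(2) \<phi>]
    by (simp add: edge_graph_image_iff[OF assms])
qed

lemma quasi_random_graph_image:
  assumes "\<And>n. simple_graph (G n)" "\<And>n. inj_on (f n) (verts (G n))"
  shows "quasi_random q (\<lambda>n. graph_image (f n) (G n)) \<longleftrightarrow> quasi_random q G"
  using assms
  by (simp add: quasi_random_def graph_sequence_def num_injhom_graph_image card_image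
      simple_graph_graph_image)

lemma quasi_random_pair_graph_image:
  assumes "\<And>n. simple_graph (G n)" "\<And>n. inj_on (f n) (verts (G n))"
  shows "quasi_random_pair p p' (\<lambda>n. graph_image (f n) (G n)) \<longleftrightarrow> quasi_random_pair p p' G"
proof -
  \<comment> \<open>The arbitrary reindexing \<open>r\<close> covers the subsequences along
    \<open>enumerate\<close>.\<close>
  have "quasi_random q (\<lambda>n. graph_image (f (r n)) (G (r n))) \<longleftrightarrow> quasi_random q (\<lambda>n. G (r n))" for q r
    using assms by (intro quasi_random_graph_image[of "\<lambda>n. G (r n)" "\<lambda>n. f (r n)"])
  then show ?thesis by (simp add: quasi_random_pair_def)
qed

text \<open>The definition tests only graphs with vertices in \<open>nat\<close>. Each
  \<open>G n\<close> is finite, hence has an injective relabelling into \<open>nat\<close>, which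
  preserves the hypothesis and the conclusion.\<close>

lemma hereditary_induced_forcingD:
  fixes G :: "nat \<Rightarrow> 'a ugraph"
  assumes F: "hereditary_induced_forcing F p" and G: "graph_sequence G" and "\<epsilon> \<longlonglongrightarrow> 0"
    and close: "\<And>n U. U \<subseteq> verts (G n) \<Longrightarrow>
      \<bar>real (num_induced F (G n) U) - beta F p * real (card U) ^ gorder F\<bar>
        \<le> \<epsilon> n * real (gorder (G n)) ^ gorder F"
  shows "quasi_random_pair p (conjugate F p) G"
proof -
  have simple: "simple_graph (G n)" for n using G by (simp add: graph_sequence_def)
  have "\<exists>f :: 'a \<Rightarrow> nat. inj_on f (verts (G n))" for n
    using simple[of n] finite_imp_inj_to_nat_seg[of "verts (G n)"] by (auto simp: simple_graph_def)
  then obtain f :: "nat \<Rightarrow> 'a \<Rightarrow> nat" where f: "\<And>n. inj_on (f n) (verts (G n))" by metis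
  let ?G = "\<lambda>n. graph_image (f n) (G n)"
  have seq: "graph_sequence ?G"
    using G f by (simp add: graph_sequence_def card_image simple_graph_graph_image)
  have "\<bar>real (num_induced F (?G n) U) - beta F p * real (card U) ^ gorder F\<bar>
      \<le> \<epsilon> n * real (gorder (?G n)) ^ gorder F" if U: "U \<subseteq> verts (?G n)" for n U
  proof -
    obtain U' where U': "U' \<subseteq> verts (G n)" "U = f n ` U'"
      using U by (auto simp: subset_image_iff)
    then have "card U = card U'" using card_image[OF inj_on_subset[OF f U'(1)]] by simp
    with close[OF U'(1)] U' show ?thesis
      using num_induced_graph_image[OF simple f U'(1), of F] by (simp add: card_image f)
  qed
  with assms(3) have "\<exists>\<epsilon>. \<epsilon> \<longlonglongrightarrow> 0 \<and> (\<forall>n. \<forall>U \<subseteq> verts (?G n).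
      \<bar>real (num_induced F (?G n) U) - beta F p * real (card U) ^ gorder F\<bar>
        \<le> \<epsilon> n * real (gorder (?G n)) ^ gorder F)"
    by (intro exI[of _ \<epsilon>] conjI allI impI)
  with F seq have "quasi_random_pair p (conjugate F p) ?G"
    unfolding hereditary_induced_forcing_def by (elim allE[of _ ?G] impE) 
  then show ?thesis by (simp add: quasi_random_pair_graph_image simple f)
qed

theorem theorem3p13:
  fixes \<gamma> p :: real and k :: nat and F :: "nat ugraph"
    and G :: "nat \<Rightarrow> 'a ugraph" and \<epsilon> :: "nat \<Rightarrow> real"
  assumes "0 < \<gamma>" and "\<gamma> < 1"
    and "0 \<le> p" and "p \<le> 1"
    and "simple_graph F" and "verts F = {1..k}"
    and "hereditary_induced_forcing F p"
    and "graph_sequence G"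
    and "\<epsilon> \<longlonglongrightarrow> 0"
    and "\<And>n U. U \<subseteq> verts (G n) \<Longrightarrow> int (card U) = \<lfloor>\<gamma> * real (gorder (G n))\<rfloor> \<Longrightarrow>
           \<bar>real (num_induced F (G n) U) - beta F p * real (card U) ^ k\<bar>
             \<le> \<epsilon> n * real (gorder (G n)) ^ k"
  shows "quasi_random_pair p (conjugate F p) G"
proof (rule num_induced_close_all_subsets[OF assms(1,2), where ?'a = 'a and F = F])
  show "finite (verts F)" by (simp add: assms(6))
next
  have k: "gorder F = k" using assms(6) by simp
  fix C
  assume C: "\<And>(G :: 'a ugraph) \<beta> e U.
    \<lbrakk>finite (verts G); verts G \<noteq> {}; 0 \<le> \<beta>; \<beta> \<le> 1;
      \<And>W. W \<subseteq> verts G \<Longrightarrow> int (card W) = \<lfloor>\<gamma> * real (gorder G)\<rfloor> \<Longrightarrow>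
        \<bar>real (num_induced F G W) - \<beta> * real (card W) ^ gorder F\<bar> \<le> e * real (gorder G) ^ gorder F;
      U \<subseteq> verts G\<rbrakk> \<Longrightarrow>
    \<bar>real (num_induced F G U) - \<beta> * real (card U) ^ gorder F\<bar>
      \<le> C * (e + real (gorder F) * (sqrt (gorder G) + 2) / gorder G) * real (gorder G) ^ gorder F"
  define N where "N n = gorder (G n)" for n
  define \<delta> where "\<delta> n = C * (\<epsilon> n + real k * (sqrt (N n) + 2) / N n)" for n
  have fin: "finite (verts (G n))" for n
    using assms(8) by (simp add: graph_sequence_def simple_graph_def)
  have lim: "filterlim (\<lambda>n. real (N n)) at_top sequentially"
    using assms(8) unfolding graph_sequence_def N_def
    by (intro filterlim_compose[OF filterlim_real_sequentially]) simp
  have "((\<lambda>x::real. (sqrt x + 2) / x) \<longlongrightarrow> 0) at_top"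
    by real_asymp
  then have "(\<lambda>n. (sqrt (N n) + 2) / N n) \<longlonglongrightarrow> 0"
    using lim by (rule filterlim_compose)
  from tendsto_mult_right_zero[OF this, of "real k"]
  have "(\<lambda>n. real k * (sqrt (N n) + 2) / N n) \<longlonglongrightarrow> 0" by simp
  from tendsto_mult_right_zero[OF tendsto_add_zero[OF assms(9) this], of C]
  have \<delta>: "\<delta> \<longlonglongrightarrow> 0" unfolding \<delta>_def[abs_def] .
  \<comment> \<open>A graph without vertices is outside the scope of \<open>C\<close>. There the
    only subset is empty and has the prescribed size 0, so \<open>\<epsilon> n\<close> itself
    serves; this affects finitely many \<open>n\<close> only, and the limit stays 0.\<close>
  define \<eta> where "\<eta> n = (if N n = 0 then \<epsilon> n else \<delta> n)" for n
  have "\<forall>\<^sub>F n in sequentially. N n > 0"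
    using filterlim_at_top_dense[THEN iffD1, OF lim, rule_format, of 0] by simp
  then have "\<forall>\<^sub>F n in sequentially. \<delta> n = \<eta> n"
    by eventually_elim (simp add: \<eta>_def)
  with \<delta> have "\<eta> \<longlonglongrightarrow> 0" by (rule Lim_transform_eventually)
  then show ?thesis
  proof (rule hereditary_induced_forcingD[OF assms(7,8)])
    fix n U assume U: "U \<subseteq> verts (G n)"
    show "\<bar>real (num_induced F (G n) U) - beta F p * real (card U) ^ gorder F\<bar>
        \<le> \<eta> n * real (gorder (G n)) ^ gorder F"
    proof (cases "N n = 0")
      case True
      then have "verts (G n) = {}" using fin by (simp add: N_def)
      then show ?thesis using assms(10)[OF U] U True by (simp add: k \<eta>_def)
    next
      case False
      then have "verts (G n) \<noteq> {}" by (auto simp: N_def)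
      from C[unfolded k, OF fin this beta_bounds[OF assms(3,4)] assms(10) U] False
      show ?thesis by (simp add: k \<eta>_def \<delta>_def N_def)
    qed
  qed
qed

end
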